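(* (Five lemma) Let $$\begin{array}{ccccccccc}V_1&\to&V_2&\to&V_3&\xrightarrow{d_3}&V_4&\to&V_5\\ \downarrow{\scriptstyle f_1}&&\downarrow{\scriptstyle f_2}&&\downarrow{\scriptstyle f_3}&&\downarrow{\scriptstyle f_4}&&\downarrow{\scriptstyle f_5}\\ W_1&\to&W_2&\xrightarrow{\partial_2}&W_3&\to&W_4&\to&W_5\end{array}$$ be a commutative diagram in $\mathrm{DVect}$ such that both rows are exact in the category of vector spaces, $f_1$ is surjective, $f_5$ is injective, and both $f_2$ and $f_4$ are isomorphisms in $\mathrm{DVect}$. If the induced map $V_3\to\operatorname{Im}(d_3)$ is a subduction and the induced map $W_2/\ker(\partial_2)\to W_3$ is an induction, then $f_3$ is an isomorphism in $\mathrm{DVect}$.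
   Context: A diffeological space is a set $X$ together with a specified set of functions $U\to X$ (called plots), for every open set $U\subseteq\mathbb{R}^n$ and every $n\in\mathbb{N}=\{0,1,2,\dots\}$, such that: (1) every constant map $U\to X$ is a plot; (2) if $U\to X$ is a plot and $V\to U$ is a smooth map between open subsets of Euclidean spaces, then $V\to U\to X$ is a plot; (3) if $U=\bigcup_i U_i$ is an open cover and $U\to X$ is a map whose restrictions to all $U_i$ are plots, then $U\to X$ is a plot. A map between diffeological spaces is smooth if composing with it sends plots to plots. Products carry the product diffeology (a map into a product is a plot iff all its components are plots), and $\mathbb{R}$ carries the standard diffeology. Subsets (such as $\operatorname{Im}(d_3)\subseteq V_4$) carry the sub-diffeology (plots are the plots of the ambient space with image in the subset); quotients (such as $W_2/\ker(\partial_2)$) carry the quotient diffeology (plots are the maps that locally lift to plots). A diffeological vector space is a real vector space $V$ with a diffeology such that addition $V\times V\to V$ and scalar multiplication $\mathbb{R}\times V\to V$ are smooth. $\mathrm{DVect}$ is the category of diffeological vector spaces and smooth linear maps; an isomorphism in $\mathrm{DVect}$ is a smooth linear bijection with smooth inverse. A map $f:X\to Y$ of diffeological spaces is an induction if it is injective and a map $q:U\to X$ is a plot iff $f\circ q$ is a plot of $Y$. It is a subduction if it is smooth, surjective, and every plot of $Y$ locally (near each point of its domain) lifts along $f$ to a plot of $X$. *)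

theory Defs
  imports "HOL-Analysis.Analysis"
begin

text \<open>
  Euclidean spaces of all dimensions live in the single type \<open>nat \<Rightarrow> real\<close>: the points of
  \<open>Euclidean_space n\<close> are the sequences vanishing at all indices \<open>\<ge> n\<close>.
  A function is of class $C^k$ if all its iterated partial derivatives up to order \<open>k\<close>
  exist and are continuous on \<open>U\<close>. For \<open>U\<close> open in \<open>Euclidean_space n\<close> and \<open>i < n\<close>, the
  derivative at \<open>x \<in> U\<close> only depends on the values of \<open>f\<close> on \<open>U\<close>.
\<close>

primrec C_k_on :: "nat \<Rightarrow> nat \<Rightarrow> (nat \<Rightarrow> real) set \<Rightarrow> ((nat \<Rightarrow> real) \<Rightarrow> real) \<Rightarrow> bool" where
  "C_k_on 0 n U f \<longleftrightarrow> continuous_map (subtopology (Euclidean_space n) U) euclideanreal f"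
| "C_k_on (Suc k) n U f \<longleftrightarrow>
     continuous_map (subtopology (Euclidean_space n) U) euclideanreal f \<and>
     (\<forall>i<n. \<exists>g. (\<forall>x\<in>U. ((\<lambda>t. f (x(i := t))) has_real_derivative g x) (at (x i))) \<and>
                C_k_on k n U g)"

definition smooth_real_on :: "nat \<Rightarrow> (nat \<Rightarrow> real) set \<Rightarrow> ((nat \<Rightarrow> real) \<Rightarrow> real) \<Rightarrow> bool" where
  "smooth_real_on n U f \<longleftrightarrow> (\<forall>k. C_k_on k n U f)"

definition smooth_euclidean ::
  "nat \<Rightarrow> (nat \<Rightarrow> real) set \<Rightarrow> nat \<Rightarrow> (nat \<Rightarrow> real) set \<Rightarrow> ((nat \<Rightarrow> real) \<Rightarrow> (nat \<Rightarrow> real)) \<Rightarrow> bool" where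
  "smooth_euclidean m V n U h \<longleftrightarrow>
     h \<in> V \<rightarrow> U \<and> (\<forall>j<n. smooth_real_on m V (\<lambda>x. h x j))"

text \<open>
  \<open>plots X n U\<close> is the set of plots \<open>U \<rightarrow> X\<close> for \<open>U\<close> open in \<open>Euclidean_space n\<close>. A function
  with domain \<open>U\<close> is represented by its extensional representative, so that plots with
  domain \<open>U\<close> are determined by their values on \<open>U\<close>.
\<close>

record 'a dspace =
  points :: "'a set"
  plots :: "nat \<Rightarrow> (nat \<Rightarrow> real) set \<Rightarrow> ((nat \<Rightarrow> real) \<Rightarrow> 'a) set"

locale diffeological_space =
  fixes X :: "'a dspace"
  assumes plots_open: "p \<in> plots X n U \<Longrightarrow> openin (Euclidean_space n) U"
    and plots_funcset: "p \<in> plots X n U \<Longrightarrow> p \<in> U \<rightarrow>\<^sub>E points X"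
    and plots_const: "\<lbrakk>openin (Euclidean_space n) U; c \<in> points X\<rbrakk> \<Longrightarrow> (\<lambda>x\<in>U. c) \<in> plots X n U"
    and plots_compose:
      "\<lbrakk>p \<in> plots X n U; openin (Euclidean_space m) V; smooth_euclidean m V n U h\<rbrakk>
        \<Longrightarrow> compose V p h \<in> plots X m V"
    and plots_local:
      "\<lbrakk>\<And>V. V \<in> \<U> \<Longrightarrow> openin (Euclidean_space n) V; U = \<Union>\<U>; p \<in> U \<rightarrow>\<^sub>E points X;
        \<And>V. V \<in> \<U> \<Longrightarrow> restrict p V \<in> plots X n V\<rbrakk>
        \<Longrightarrow> p \<in> plots X n U"

definition dsmooth :: "'a dspace \<Rightarrow> 'b dspace \<Rightarrow> ('a \<Rightarrow> 'b) \<Rightarrow> bool" where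
  "dsmooth X Y f \<longleftrightarrow>
     f \<in> points X \<rightarrow> points Y \<and> (\<forall>n U. \<forall>p \<in> plots X n U. compose U f p \<in> plots Y n U)"

definition real_dspace :: "real dspace" where
  "real_dspace = \<lparr> points = UNIV,
     plots = (\<lambda>n U. {p \<in> extensional U. openin (Euclidean_space n) U \<and> smooth_real_on n U p}) \<rparr>"

definition prod_dspace :: "'a dspace \<Rightarrow> 'b dspace \<Rightarrow> ('a \<times> 'b) dspace" where
  "prod_dspace X Y = \<lparr> points = points X \<times> points Y,
     plots = (\<lambda>n U. {p \<in> extensional U.
       compose U fst p \<in> plots X n U \<and> compose U snd p \<in> plots Y n U}) \<rparr>"

definition sub_dspace :: "'a dspace \<Rightarrow> 'a set \<Rightarrow> 'a dspace" where
  "sub_dspace X A = \<lparr> points = A, plots = (\<lambda>n U. {p \<in> plots X n U. p ` U \<subseteq> A}) \<rparr>"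

definition quot_dspace :: "'a dspace \<Rightarrow> 'a rel \<Rightarrow> 'a set dspace" where
  "quot_dspace X r = \<lparr> points = points X // r,
     plots = (\<lambda>n U. {q \<in> U \<rightarrow>\<^sub>E points X // r. openin (Euclidean_space n) U \<and>
       (\<forall>x\<in>U. \<exists>V. openin (Euclidean_space n) V \<and> x \<in> V \<and> V \<subseteq> U \<and>
          (\<exists>p \<in> plots X n V. \<forall>y\<in>V. q y = r `` {p y}))}) \<rparr>"

definition induction_map :: "'a dspace \<Rightarrow> 'b dspace \<Rightarrow> ('a \<Rightarrow> 'b) \<Rightarrow> bool" where
  "induction_map X Y f \<longleftrightarrow>
     f \<in> points X \<rightarrow> points Y \<and> inj_on f (points X) \<and>
     (\<forall>n U. openin (Euclidean_space n) U \<longrightarrow>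
        (\<forall>q \<in> U \<rightarrow>\<^sub>E points X. q \<in> plots X n U \<longleftrightarrow> compose U f q \<in> plots Y n U))"

definition subduction_map :: "'a dspace \<Rightarrow> 'b dspace \<Rightarrow> ('a \<Rightarrow> 'b) \<Rightarrow> bool" where
  "subduction_map X Y f \<longleftrightarrow>
     dsmooth X Y f \<and> f ` points X = points Y \<and>
     (\<forall>n U. \<forall>q \<in> plots Y n U. \<forall>x\<in>U. \<exists>V. openin (Euclidean_space n) V \<and> x \<in> V \<and> V \<subseteq> U \<and>
        (\<exists>p \<in> plots X n V. \<forall>y\<in>V. q y = f (p y)))"

text \<open>The underlying real vector space is the whole type.\<close>

locale diff_vector_space = diffeological_space V
  for V :: "'a::real_vector dspace" +
  assumes points_UNIV: "points V = UNIV"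
    and smooth_add: "dsmooth (prod_dspace V V) V (\<lambda>(x, y). x + y)"
    and smooth_scaleR: "dsmooth (prod_dspace real_dspace V) V (\<lambda>(a, x). a *\<^sub>R x)"

definition DVect_hom ::
  "'a::real_vector dspace \<Rightarrow> 'b::real_vector dspace \<Rightarrow> ('a \<Rightarrow> 'b) \<Rightarrow> bool" where
  "DVect_hom V W f \<longleftrightarrow> linear f \<and> dsmooth V W f"

definition DVect_iso ::
  "'a::real_vector dspace \<Rightarrow> 'b::real_vector dspace \<Rightarrow> ('a \<Rightarrow> 'b) \<Rightarrow> bool" where
  "DVect_iso V W f \<longleftrightarrow> DVect_hom V W f \<and> bij f \<and> dsmooth W V (inv f)"

definition ker :: "('a::real_vector \<Rightarrow> 'b::real_vector) \<Rightarrow> 'a set" where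
  "ker f = {x. f x = 0}"

definition exact_at ::
  "('a::real_vector \<Rightarrow> 'b::real_vector) \<Rightarrow> ('b \<Rightarrow> 'c::real_vector) \<Rightarrow> bool" where
  "exact_at f g \<longleftrightarrow> range f = ker g"

definition quot_by :: "'a::real_vector dspace \<Rightarrow> 'a set \<Rightarrow> 'a set dspace" where
  "quot_by V K = quot_dspace V {(x, y). x - y \<in> K}"

text \<open>If \<open>f\<close> is constant on the coset \<open>C\<close>, then \<open>f ` C\<close> is the singleton of that value.\<close>

definition induced_map :: "('a \<Rightarrow> 'b) \<Rightarrow> 'a set \<Rightarrow> 'b" where
  "induced_map f C = the_elem (f ` C)"

end

theory Submission
  imports Defs
begin

text \<open>
  Bijectivity of \<open>f3\<close> is the algebraic five lemma. To see that its inverse is smooth, let \<open>q\<close> be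
  a plot of \<open>W3\<close>. The plot \<open>f4\<^sup>-\<^sup>1 \<circ> e3 \<circ> q\<close> takes values in the image of \<open>d3\<close>, so it
  locally lifts to a plot \<open>p\<close> of \<open>V3\<close>. The plot \<open>q - f3 \<circ> p\<close> is annihilated by \<open>e3\<close>, hence takes
  values in the image of \<open>e2\<close>. As the map from \<open>W2\<close> modulo the kernel of \<open>e2\<close> to \<open>W3\<close> is an
  induction, this plot lifts locally to a plot \<open>r\<close> of \<open>W2\<close>. Then \<open>p + d2 \<circ> f2\<^sup>-\<^sup>1 \<circ> r\<close> is a plot of \<open>V3\<close> which agrees locally with \<open>f3\<^sup>-\<^sup>1 \<circ> q\<close>.
\<close>

section \<open>Smoothness of constants, coordinates and inclusions\<close>

lemma C_k_on_const: "C_k_on k n U (\<lambda>x. c)"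
  by (induction k arbitrary: c) (auto intro!: exI[of _ "\<lambda>x. 0"])

text \<open>Plots of \<open>real_dspace\<close> are extensional, so a constant plot is
  \<open>undefined\<close> off \<open>U\<close>. Since \<open>U\<close> is open, a coordinate line
  through a point of \<open>U\<close> stays in \<open>U\<close> for nearby parameters, so the
  partial derivatives still vanish.\<close>

lemma C_k_on_restrict_const:
  assumes U: "openin (Euclidean_space n) U"
  shows "C_k_on k n U (\<lambda>x\<in>U. c)"
proof -
  have cont: "continuous_map (subtopology (Euclidean_space n) U) euclideanreal (\<lambda>x\<in>U. c)"
    by (rule continuous_map_eq[of _ _ "\<lambda>x. c"]) auto
  show ?thesis
  proof (cases k)
    case (Suc k')
    have "((\<lambda>t. (\<lambda>x\<in>U. c) (x(i := t))) has_real_derivative 0) (at (x i))"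
      if "x \<in> U" "i < n" for x i
    proof -
      \<comment> \<open>\<open>U\<close> is open only inside the subspace where the coordinates from
        \<open>n\<close> on are zero. Changing a coordinate \<open>i < n\<close> keeps those zeros,
        so it is enough to stay in the ambient open set \<open>T\<close>.\<close>
      obtain T where T: "openin (product_topology (\<lambda>_. euclideanreal) UNIV) T"
        "U = T \<inter> {x. \<forall>i\<ge>n. x i = 0}"
        using U by (auto simp: Euclidean_space_def openin_subtopology)
      have "continuous_map euclideanreal (product_topology (\<lambda>_. euclideanreal) UNIV) (\<lambda>t. x(i := t))"
        by (auto simp: continuous_map_componentwise_UNIV)
      from openin_continuous_map_preimage[OF this T(1)]
      have "open {t. x(i := t) \<in> T}" by simp
      moreover have "x i \<in> {t. x(i := t) \<in> T}" using that T by simp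
      moreover have "c = (\<lambda>x\<in>U. c) (x(i := t))" if "t \<in> {t. x(i := t) \<in> T}" for t
        using that \<open>x \<in> U\<close> \<open>i < n\<close> T(2) by auto
      ultimately show ?thesis
        by (rule DERIV_const[THEN has_field_derivative_transform_within_open])
    qed
    \<comment> \<open>The derivative witness is the unrestricted zero function, which
      \<open>C_k_on_const\<close> covers at every order; hence a case split replaces
      induction.\<close>
    with cont Suc show ?thesis by (auto intro!: exI[of _ "\<lambda>x. 0"] C_k_on_const simp del: restrict_apply)
  qed (simp add: cont)
qed

lemma C_k_on_coordinate: "C_k_on k n U (\<lambda>x. x j)"
proof -
  have cont: "continuous_map (subtopology (Euclidean_space n) U) euclideanreal (\<lambda>x. x j)"
    unfolding Euclidean_space_def subtopology_subtopology
    by (intro continuous_map_from_subtopology continuous_map_product_projection) simp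
  show ?thesis
  proof (cases k)
    case (Suc k')
    have "\<exists>g. (\<forall>x\<in>U. ((\<lambda>t. (x(i := t)) j) has_real_derivative g x) (at (x i))) \<and> C_k_on k' n U g"
      for i
      by (rule exI[of _ "\<lambda>x. if i = j then 1 else 0"]) (auto simp: C_k_on_const)
    with cont Suc show ?thesis by simp
  qed (simp add: cont)
qed

text \<open>Precomposing with this map is restriction, so \<open>plots_compose\<close> yields that
  plots restrict to open subsets.\<close>

lemma smooth_euclidean_inclusion:
  assumes "V \<subseteq> U"
  shows "smooth_euclidean n V n U (\<lambda>x. x)"
  using assms by (auto simp: smooth_euclidean_def smooth_real_on_def C_k_on_coordinate)

section \<open>Locality of plots and of smooth maps\<close>

context diffeological_space
begin

lemma plots_restrict:
  assumes "p \<in> plots X n U" "openin (Euclidean_space n) V" "V \<subseteq> U"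
  shows "restrict p V \<in> plots X n V"
  using plots_compose[OF assms(1,2) smooth_euclidean_inclusion[OF assms(3)]]
  by (simp add: compose_def)

lemma plots_if_locally:
  assumes "p \<in> U \<rightarrow>\<^sub>E points X"
    and "\<And>x. x \<in> U \<Longrightarrow> \<exists>V. openin (Euclidean_space n) V \<and> x \<in> V \<and> V \<subseteq> U \<and>
           restrict p V \<in> plots X n V"
  shows "p \<in> plots X n U"
proof (rule plots_local)
  \<comment> \<open>The cover for the gluing axiom: all open subsets on which \<open>p\<close> is
    already a plot.\<close>
  let ?\<U> = "{V. openin (Euclidean_space n) V \<and> V \<subseteq> U \<and> restrict p V \<in> plots X n V}"
  show "U = \<Union>?\<U>"
    using assms(2) by blast
qed (use assms(1) in auto)

end

lemma dsmooth_plots: "dsmooth X Y f \<Longrightarrow> p \<in> plots X n U \<Longrightarrow> (\<lambda>x\<in>U. f (p x)) \<in> plots Y n U"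
  unfolding dsmooth_def compose_def by blast

lemma dsmooth_if_locally:
  assumes "diffeological_space X" "diffeological_space Y" "f \<in> points X \<rightarrow> points Y"
    and "\<And>n U q x. \<lbrakk>q \<in> plots X n U; x \<in> U\<rbrakk> \<Longrightarrow>
           \<exists>V. openin (Euclidean_space n) V \<and> x \<in> V \<and> V \<subseteq> U \<and>
             (\<exists>p \<in> plots Y n V. \<forall>y\<in>V. f (q y) = p y)"
  shows "dsmooth X Y f"
  unfolding dsmooth_def
proof (intro conjI allI ballI)
  interpret X: diffeological_space X by fact
  interpret Y: diffeological_space Y by fact
  fix n U q assume q: "q \<in> plots X n U"
  show "compose U f q \<in> plots Y n U"
  proof (rule Y.plots_if_locally)
    show "compose U f q \<in> U \<rightarrow>\<^sub>E points Y"
      using X.plots_funcset[OF q] assms(3) by (auto simp: compose_def)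
    fix x assume "x \<in> U"
    then obtain V p where V: "openin (Euclidean_space n) V" "x \<in> V" "V \<subseteq> U"
      and p: "p \<in> plots Y n V" "\<forall>y\<in>V. f (q y) = p y"
      using assms(4)[OF q] by meson
    \<comment> \<open>Plots are extensional, so agreement on \<open>V\<close> is equality of
      functions.\<close>
    have "restrict (compose U f q) V = p"
      using p V(3) Y.plots_funcset[OF p(1)]
      by (intro ext) (auto simp: compose_def restrict_def PiE_def extensional_def)
    with V p(1)
    show "\<exists>V. openin (Euclidean_space n) V \<and> x \<in> V \<and> V \<subseteq> U \<and>
        restrict (compose U f q) V \<in> plots Y n V"
      by auto
  qed
qed (fact assms(3))

section \<open>Pointwise vector operations on plots\<close>

context diff_vector_space
begin

lemma plots_add:
  assumes p: "p \<in> plots V n U" and q: "q \<in> plots V n U"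
  shows "(\<lambda>x\<in>U. p x + q x) \<in> plots V n U"
proof -
  have "compose U fst (\<lambda>x\<in>U. (p x, q x)) = p" "compose U snd (\<lambda>x\<in>U. (p x, q x)) = q"
    using plots_funcset[OF p] plots_funcset[OF q]
    by (auto simp: compose_def restrict_def PiE_def extensional_def)
  with p q have "(\<lambda>x\<in>U. (p x, q x)) \<in> plots (prod_dspace V V) n U"
    by (simp add: prod_dspace_def)
  from dsmooth_plots[OF smooth_add this] show ?thesis
    by (simp cong: restrict_cong)
qed

text \<open>A fixed scalar is a constant plot of the real line; paired with \<open>p\<close> it is a
  plot of the product, to which \<open>smooth_scaleR\<close> applies.\<close>

lemma plots_scaleR:
  assumes p: "p \<in> plots V n U"
  shows "(\<lambda>x\<in>U. a *\<^sub>R p x) \<in> plots V n U"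
proof -
  have "(\<lambda>x\<in>U. a) \<in> plots real_dspace n U"
    using plots_open[OF p] by (simp add: real_dspace_def smooth_real_on_def C_k_on_restrict_const)
  moreover have "compose U fst (\<lambda>x\<in>U. (a, p x)) = (\<lambda>x\<in>U. a)"
    "compose U snd (\<lambda>x\<in>U. (a, p x)) = p"
    using plots_funcset[OF p]
    by (auto simp: compose_def restrict_def PiE_def extensional_def)
  ultimately have "(\<lambda>x\<in>U. (a, p x)) \<in> plots (prod_dspace real_dspace V) n U"
    using p by (simp add: prod_dspace_def)
  from dsmooth_plots[OF smooth_scaleR this] show ?thesis
    by (simp cong: restrict_cong)
qed

lemma plots_diff:
  assumes "p \<in> plots V n U" "q \<in> plots V n U"
  shows "(\<lambda>x\<in>U. p x - q x) \<in> plots V n U"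
  using plots_add[OF assms(1) plots_scaleR[OF assms(2), of "-1"]]
  by (simp cong: restrict_cong)

end

section \<open>Lifting plots along the map induced on a quotient\<close>

lemma induced_map_coset:
  assumes "linear e"
  shows "induced_map e {y. a - y \<in> ker e} = e a"
proof -
  have "e ` {y. a - y \<in> ker e} = {e a}"
    using assms by (auto simp: ker_def linear_diff intro!: image_eqI[of _ _ a])
  thus ?thesis by (simp add: induced_map_def)
qed

text \<open>Pointwise preimages of \<open>g\<close> need not form a plot, but their classes modulo
  the kernel give a map \<open>s\<close> with \<open>induced_map e\<close> after \<open>s\<close>
  equal to \<open>g\<close>. The induction property makes \<open>s\<close> a plot of the quotient,
  and such plots lift locally to \<open>W\<close>.\<close>

lemma induction_map_lift:
  assumes e: "linear e" and W: "points W = UNIV"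
    and ind: "induction_map (quot_by W (ker e)) Y (induced_map e)"
    and g: "openin (Euclidean_space n) U" "g \<in> extensional U" "g \<in> plots Y n U"
    and im: "\<And>y. y \<in> U \<Longrightarrow> g y \<in> range e" and x: "x \<in> U"
  shows "\<exists>V. openin (Euclidean_space n) V \<and> x \<in> V \<and> V \<subseteq> U \<and>
    (\<exists>p \<in> plots W n V. \<forall>y\<in>V. g y = e (p y))"
proof -
  let ?r = "{(x, y). x - y \<in> ker e}"
  \<comment> \<open>\<open>inv e\<close> is an arbitrary choice; the class of the chosen preimage
    does not depend on it.\<close>
  define s where "s = (\<lambda>y\<in>U. ?r `` {inv e (g y)})"
  have "?r `` {a} \<in> points (quot_by W (ker e))" for a
    unfolding quot_by_def quot_dspace_def W by (simp only: dspace.simps) (rule quotientI, simp)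
  hence "s \<in> U \<rightarrow>\<^sub>E points (quot_by W (ker e))"
    unfolding s_def by (intro restrict_PiE_iff[THEN iffD2] ballI)
  moreover have "compose U (induced_map e) s = g"
    using g(2) im
    by (intro ext) (auto simp: compose_def s_def induced_map_coset[OF e] f_inv_into_f
        restrict_def extensional_def)
  ultimately have "s \<in> plots (quot_by W (ker e)) n U"
    using ind g by (auto simp: induction_map_def)
  hence "\<forall>x\<in>U. \<exists>V. openin (Euclidean_space n) V \<and> x \<in> V \<and> V \<subseteq> U \<and>
      (\<exists>p \<in> plots W n V. \<forall>y\<in>V. s y = ?r `` {p y})"
    by (simp add: quot_by_def quot_dspace_def)
  then obtain V p where V: "openin (Euclidean_space n) V" "x \<in> V" "V \<subseteq> U"
    and p: "p \<in> plots W n V" "\<forall>y\<in>V. s y = ?r `` {p y}"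
    using x by meson
  have "g y = e (p y)" if "y \<in> V" for y
  proof -
    have "e (inv e (g y)) = induced_map e (s y)"
      using that V(3) by (auto simp: s_def induced_map_coset[OF e])
    also have "\<dots> = e (p y)"
      using that p(2) by (simp add: induced_map_coset[OF e])
    finally show ?thesis
      using im[of y] that V(3) by (auto simp: f_inv_into_f)
  qed
  with V p(1) show ?thesis by blast
qed

section \<open>Algebraic diagram chases\<close>

lemma exact_at_iff: "exact_at f g \<Longrightarrow> g y = 0 \<longleftrightarrow> (\<exists>x. y = f x)"
  by (auto simp: exact_at_def ker_def set_eq_iff image_iff)

text \<open>An \<open>x\<close> killed by \<open>f3\<close> is also killed by \<open>d3\<close>, so
  it comes from some \<open>v\<close>. Then \<open>f2 v\<close> comes from \<open>e1\<close>, and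
  surjectivity of \<open>f1\<close> moves this back to \<open>v = d1 u\<close>, which
  \<open>d2\<close> kills.\<close>

lemma five_lemma_inj:
  assumes lin: "linear f3" "linear f4" "linear e3"
    and commutes: "f2 \<circ> d1 = e1 \<circ> f1" "f3 \<circ> d2 = e2 \<circ> f2" "f4 \<circ> d3 = e3 \<circ> f3"
    and exact: "exact_at d1 d2" "exact_at d2 d3" "exact_at e1 e2"
    and "surj f1" "inj f2" "inj f4"
  shows "inj f3"
proof -
  have "x = 0" if x: "f3 x = 0" for x
  proof -
    have "f4 (d3 x) = 0"
      using x comp_eq_dest[OF commutes(3), of x] lin by (simp add: linear_0)
    hence "d3 x = 0"
      using \<open>inj f4\<close> lin by (metis injD linear_0)
    then obtain v where v: "x = d2 v"
      using exact_at_iff[OF exact(2)] by blast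
    hence "e2 (f2 v) = 0"
      using x comp_eq_dest[OF commutes(2), of v] by simp
    then obtain w where "f2 v = e1 w"
      using exact_at_iff[OF exact(3)] by blast
    moreover obtain u where "w = f1 u"
      using \<open>surj f1\<close> by (metis surjD)
    ultimately have "f2 v = f2 (d1 u)"
      using comp_eq_dest[OF commutes(1), of u] by simp
    hence "v = d1 u" using \<open>inj f2\<close> by (simp add: inj_eq)
    thus "x = 0" using v exact_at_iff[OF exact(1)] by blast
  qed
  thus ?thesis using lin by (simp add: linear_injective_0)
qed

text \<open>The start of the surjectivity chase: \<open>e4\<close> kills \<open>e3 w\<close>, and
  injectivity of \<open>f5\<close> transfers this to \<open>d4\<close>. It also places a whole plot
  inside the image of \<open>d3\<close>.\<close>

lemma five_lemma_range_lift:
  assumes lin: "linear f5"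
    and commutes: "f4 \<circ> d3 = e3 \<circ> f3" "f5 \<circ> d4 = e4 \<circ> f4"
    and exact: "exact_at d3 d4" "exact_at e3 e4"
    and "bij f4" "inj f5"
  shows "inv f4 (e3 w) \<in> range d3"
proof -
  have "f5 (d4 (inv f4 (e3 w))) = e4 (e3 w)"
    using comp_eq_dest[OF commutes(2), of "inv f4 (e3 w)"] \<open>bij f4\<close>
    by (simp add: bij_is_surj surj_f_inv_f)
  also have "\<dots> = 0" using exact_at_iff[OF exact(2)] by blast
  finally have "d4 (inv f4 (e3 w)) = 0"
    using lin \<open>inj f5\<close> by (metis injD linear_0)
  thus ?thesis using exact_at_iff[OF exact(1)] by blast
qed

section \<open>Bijectivity and smoothness of the inverse\<close>

theorem proposition7p11:
  fixes V1 :: "'v1::real_vector dspace" and V2 :: "'v2::real_vector dspace"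
    and V3 :: "'v3::real_vector dspace" and V4 :: "'v4::real_vector dspace"
    and V5 :: "'v5::real_vector dspace"
    and W1 :: "'w1::real_vector dspace" and W2 :: "'w2::real_vector dspace"
    and W3 :: "'w3::real_vector dspace" and W4 :: "'w4::real_vector dspace"
    and W5 :: "'w5::real_vector dspace"
    and d1 :: "'v1 \<Rightarrow> 'v2" and d2 :: "'v2 \<Rightarrow> 'v3" and d3 :: "'v3 \<Rightarrow> 'v4" and d4 :: "'v4 \<Rightarrow> 'v5"
    and e1 :: "'w1 \<Rightarrow> 'w2" and e2 :: "'w2 \<Rightarrow> 'w3" and e3 :: "'w3 \<Rightarrow> 'w4" and e4 :: "'w4 \<Rightarrow> 'w5"
    and f1 :: "'v1 \<Rightarrow> 'w1" and f2 :: "'v2 \<Rightarrow> 'w2" and f3 :: "'v3 \<Rightarrow> 'w3" and f4 :: "'v4 \<Rightarrow> 'w4"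
    and f5 :: "'v5 \<Rightarrow> 'w5"
  assumes objects_V: "diff_vector_space V1" "diff_vector_space V2" "diff_vector_space V3"
      "diff_vector_space V4" "diff_vector_space V5"
    and objects_W: "diff_vector_space W1" "diff_vector_space W2" "diff_vector_space W3"
      "diff_vector_space W4" "diff_vector_space W5"
    and row_V: "DVect_hom V1 V2 d1" "DVect_hom V2 V3 d2" "DVect_hom V3 V4 d3" "DVect_hom V4 V5 d4"
    and row_W: "DVect_hom W1 W2 e1" "DVect_hom W2 W3 e2" "DVect_hom W3 W4 e3" "DVect_hom W4 W5 e4"
    and columns: "DVect_hom V1 W1 f1" "DVect_hom V2 W2 f2" "DVect_hom V3 W3 f3"
      "DVect_hom V4 W4 f4" "DVect_hom V5 W5 f5"
    and commutes: "f2 \<circ> d1 = e1 \<circ> f1" "f3 \<circ> d2 = e2 \<circ> f2" "f4 \<circ> d3 = e3 \<circ> f3" "f5 \<circ> d4 = e4 \<circ> f4"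
    and exact_V: "exact_at d1 d2" "exact_at d2 d3" "exact_at d3 d4"
    and exact_W: "exact_at e1 e2" "exact_at e2 e3" "exact_at e3 e4"
    and f1_surj: "surj f1"
    and f5_inj: "inj f5"
    and f2_iso: "DVect_iso V2 W2 f2"
    and f4_iso: "DVect_iso V4 W4 f4"
    and d3_subduction: "subduction_map V3 (sub_dspace V4 (range d3)) d3"
    and e2_induction: "induction_map (quot_by W2 (ker e2)) W3 (induced_map e2)"
  shows "DVect_iso V3 W3 f3"
proof -
  interpret V3: diff_vector_space V3 by (fact objects_V)
  interpret V4: diff_vector_space V4 by (fact objects_V)
  interpret W2: diff_vector_space W2 by (fact objects_W)
  interpret W3: diff_vector_space W3 by (fact objects_W)
  have lin: "linear d2" "linear d3" "linear e1" "linear e2" "linear e3"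
    "linear f2" "linear f3" "linear f4" "linear f5"
    using row_V row_W columns by (auto simp: DVect_hom_def)
  have smooth: "dsmooth V2 V3 d2" "dsmooth W3 W4 e3" "dsmooth V3 W3 f3"
    using row_V row_W columns by (auto simp: DVect_hom_def)
  have f2: "bij f2" "dsmooth W2 V2 (inv f2)" and f4: "bij f4" "dsmooth W4 V4 (inv f4)"
    using f2_iso f4_iso by (auto simp: DVect_iso_def)
  have inj: "inj f3"
    by (rule five_lemma_inj[OF lin(7,8,5) commutes(1-3) exact_V(1,2) exact_W(1) f1_surj])
      (use f2 f4 in \<open>auto simp: bij_is_inj\<close>)
  have im_d3: "inv f4 (e3 w) \<in> range d3" for w
    by (rule five_lemma_range_lift[OF lin(9) commutes(3,4) exact_V(3) exact_W(3) f4(1) f5_inj])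
  have im_e2: "w - f3 v \<in> range e2" if "d3 v = inv f4 (e3 w)" for v w
  proof -
    have "e3 (f3 v) = e3 w"
      using that comp_eq_dest[OF commutes(3), of v] f4(1)
      by (simp add: bij_is_surj surj_f_inv_f)
    hence "e3 (w - f3 v) = 0" by (simp add: linear_diff[OF lin(5)])
    thus ?thesis using exact_at_iff[OF exact_W(2)] by blast
  qed
  \<comment> \<open>Correcting \<open>v\<close> by \<open>d2 (inv f2 u)\<close> cancels the error
    \<open>e2 u\<close>. The same formula serves for single vectors in surjectivity and for plots in
    smoothness.\<close>
  have f3_eq: "f3 (v + d2 (inv f2 u)) = w" if "w - f3 v = e2 u" for v w u
    using that comp_eq_dest[OF commutes(2), of "inv f2 u"] f2(1)
    by (simp add: linear_add[OF lin(7)] bij_is_surj surj_f_inv_f algebra_simps)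
  have surj: "surj f3"
  proof (rule surjI)
    fix w
    obtain v where "d3 v = inv f4 (e3 w)" using im_d3[of w] by (metis rangeE)
    then obtain u where "w - f3 v = e2 u" using im_e2 by blast
    \<comment> \<open>Any preimage of \<open>w\<close> suffices here, because \<open>inv f3\<close>
      then selects one.\<close>
    from f3_eq[OF this] show "f3 (inv f3 w) = w" by (metis f_inv_into_f rangeI)
  qed
  have "dsmooth W3 V3 (inv f3)"
  proof (rule dsmooth_if_locally)
    fix n U q x
    assume q: "q \<in> plots W3 n U" and x: "x \<in> U"
    have "(\<lambda>y\<in>U. inv f4 (e3 (q y))) \<in> plots V4 n U"
      using dsmooth_plots[OF f4(2) dsmooth_plots[OF smooth(2) q]] by (simp cong: restrict_cong)
    \<comment> \<open>The subduction hypothesis concerns plots of the image of \<open>d3\<close>, so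
      the values must be known to lie there before lifting.\<close>
    hence "(\<lambda>y\<in>U. inv f4 (e3 (q y))) \<in> plots (sub_dspace V4 (range d3)) n U"
      using im_d3 by (auto simp: sub_dspace_def)
    with d3_subduction have "\<forall>x\<in>U. \<exists>V. openin (Euclidean_space n) V \<and> x \<in> V \<and> V \<subseteq> U \<and>
        (\<exists>p \<in> plots V3 n V. \<forall>y\<in>V. (\<lambda>y\<in>U. inv f4 (e3 (q y))) y = d3 (p y))"
      unfolding subduction_map_def by blast
    with x obtain V p where V: "openin (Euclidean_space n) V" "x \<in> V" "V \<subseteq> U"
      and p: "p \<in> plots V3 n V" "\<forall>y\<in>V. (\<lambda>y\<in>U. inv f4 (e3 (q y))) y = d3 (p y)"
      by meson
    have d3_p: "d3 (p y) = inv f4 (e3 (q y))" if "y \<in> V" for y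
      using p(2) V(3) that by (auto simp: subset_iff)
    define g where "g = (\<lambda>y\<in>V. q y - f3 (p y))"
    have "g \<in> plots W3 n V"
      using W3.plots_diff[OF W3.plots_restrict[OF q V(1,3)] dsmooth_plots[OF smooth(3) p(1)]]
      by (simp add: g_def cong: restrict_cong)
    moreover have "g y \<in> range e2" if "y \<in> V" for y
      using im_e2[OF d3_p] that by (simp add: g_def)
    ultimately obtain V' r where V': "openin (Euclidean_space n) V'" "x \<in> V'" "V' \<subseteq> V"
      and r: "r \<in> plots W2 n V'" "\<forall>y\<in>V'. g y = e2 (r y)"
      using induction_map_lift[OF lin(4) W2.points_UNIV e2_induction V(1) _ _ _ V(2), of g]
      by (auto simp: g_def)
    have "(\<lambda>y\<in>V'. p y + d2 (inv f2 (r y))) \<in> plots V3 n V'"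
      using V3.plots_add[OF V3.plots_restrict[OF p(1) V'(1,3)]
          dsmooth_plots[OF smooth(1) dsmooth_plots[OF f2(2) r(1)]]]
      by (simp cong: restrict_cong)
    moreover have "inv f3 (q y) = p y + d2 (inv f2 (r y))" if "y \<in> V'" for y
    \<comment> \<open>Injectivity of \<open>f3\<close> makes the local formula equal to
      \<open>inv f3\<close>, whichever lifts \<open>p\<close> and \<open>r\<close> were
      chosen.\<close>
    proof (intro inv_f_eq[OF inj] f3_eq)
      show "q y - f3 (p y) = e2 (r y)"
        using bspec[OF r(2) that] subsetD[OF V'(3) that] by (simp add: g_def)
    qed
    ultimately show "\<exists>V. openin (Euclidean_space n) V \<and> x \<in> V \<and> V \<subseteq> U \<and>
        (\<exists>p\<in>plots V3 n V. \<forall>y\<in>V. inv f3 (q y) = p y)"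
      using V' V(3) by (intro exI[of _ V'] conjI bexI[of _ "\<lambda>y\<in>V'. p y + d2 (inv f2 (r y))"]) auto
  qed (auto simp: V3.points_UNIV V3.diffeological_space_axioms W3.diffeological_space_axioms)
  thus ?thesis
    using inj surj columns(3) by (simp add: DVect_iso_def bij_def)
qed

end
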